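(* Let $r\ge4$, let $Q$ be the root lattice of the root system $\Delta$ of type $C_r$, and let $\alpha_r=2\varepsilon_r$ (the long root in the base $\varepsilon_1-\varepsilon_2,\dots,\varepsilon_{r-1}-\varepsilon_r,2\varepsilon_r$). Suppose that $(A,\iota)$ is an associative $\Lambda$-torus with involution and $s\in\mathrm{Hom}(Q,\Lambda)$ is admissible for $L(A,\iota)=\mathrm{ssp}_{2r}(A,\iota)$. Choose $0\ne h\in A^{s(\alpha_r)}$. Then the $Q\times\Lambda$-graded Lie algebras $L(A,\iota)^{(s)}$ and $L(A,\iota^{(h)})=\mathrm{ssp}_{2r}(A,\iota^{(h)})$ are graded-isomorphic (there is a Lie algebra isomorphism between them preserving the $Q\times\Lambda$-gradings).
   Context: **Conventions.** $F$ is a field of characteristic $0$; all algebras are over $F$ and (except Lie algebras) unital. $\Lambda$ is a finitely generated free abelian group. For a $\Lambda$-graded algebra $A=\bigoplus_\lambda A^\lambda$, $\mathrm{supp}_\Lambda(A)=\{\lambda:A^\lambda\ne0\}$. $\mathrm{Hom}(Q,\Lambda)$ is the group of group homomorphisms. **Associative tori with involution and isotopes.** An associative $\Lambda$-torus is a $\Lambda$-graded associative algebra $A$ such that for $\lambda\in\mathrm{supp}_\Lambda(A)$ the space $A^\lambda$ is spanned by a single invertible element, and $\Lambda$ is generated by $\mathrm{supp}_\Lambda(A)$ (then $\mathrm{supp}_\Lambda(A)=\Lambda$). An associative $\Lambda$-torus with involution is a pair $(A,\iota)$ with $A$ an associative $\Lambda$-torus and $\iota$ an antiautomorphism of $A$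 with $\iota^2=\mathrm{id}$ and $\iota(A^\lambda)=A^\lambda$. Write $\bar x=\iota(x)$ and $A_+=\{x:\bar x=x\}$ (hermitian elements). For a nonzero homogeneous hermitian $h$, $\iota^{(h)}(x)=h\bar xh^{-1}$; $(A,\iota^{(h)})$ (same product and grading on $A$) is an associative $\Lambda$-torus with involution. **$\mathrm{ssp}_{2r}(A,\iota)$.** $\Delta=\{0\}\cup\{\varepsilon_i-\varepsilon_j:1\le i\neq j\le r\}\cup\{\pm(\varepsilon_i+\varepsilon_j):1\le i\le j\le r\}$ ($\varepsilon_1,\dots,\varepsilon_r$ a basis of the space spanned by $\Delta$), $Q=\mathrm{span}_{\mathbb Z}\Delta$. Write $\bar X=(\bar x_{ij})$ for $X=(x_{ij})\in\mathrm{Mat}_r(A)$ and $[A,A]$ for the span of commutators. $L(A,\iota)=\mathrm{ssp}_{2r}(A,\iota)$ is the set of matrices $\begin{bmatrix}X&Y\\Z&-\bar X^t\end{bmatrix}$ with $X,Y,Z\in\mathrm{Mat}_r(A)$, $\bar Y^t=Y$, $\bar Z^t=Z$, $\mathrm{tr}(X)\in A_++[A,A]$, a Lie algebra under commutator. With matrix units $e_{i,j}$ put $\ell_{ij}(x)=xe_{i,j}-\bar xe_{j+r,i+r}$ ($i\ne j$), $m_{ij}(x)=xe_{i,j+r}+\bar xe_{j,i+r}$, $n_{ij}(x)=xe_{i+r,j}+\bar xe_{j+r,i}$ ($1\le i,j\le r$). It is $Q\times\Lambda$-graded by $L_{\varepsilon_i-\varepsilon_j}^\lambda=\ell_{ij}(A^\lambda)$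 ($i\neq j$), $L_{\varepsilon_i+\varepsilon_j}^\lambda=m_{ij}(A^\lambda)$, $L_{-(\varepsilon_i+\varepsilon_j)}^\lambda=n_{ij}(A^\lambda)$, $L_0^\lambda=\{\sum_{i=1}^r(x_ie_{i,i}-\bar x_ie_{i+r,i+r}):x_i\in A^\lambda,\ \sum x_i\in A_++[A,A]\}$, and $0$ for $\alpha\in Q\setminus\Delta$. It is a centreless Lie $\Lambda$-torus of type $\Delta$. **Isotopes of Lie tori.** For $s\in\mathrm{Hom}(Q,\Lambda)$, $L^{(s)}$ is the Lie algebra $L=L(A,\iota)$ with grading $(L^{(s)})_\beta^\lambda=L_\beta^{\lambda+s(\beta)}$; $s$ is admissible for $L$ if $L_\beta^{s(\beta)}\ne0$ for all $0\ne\beta\in\Delta$ (equivalently, $L^{(s)}$ is again a Lie torus). Here $s$ is admissible iff $A^{s(\alpha_r)}\subseteq A_+$, so $h$ is hermitian and $\iota^{(h)}$ is defined. *)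

theory Defs
  imports "Jordan_Normal_Form.Matrix" "HOL-Library.Poly_Mapping"
begin

section \<open>Abelian groups as modules over the integers\<close>

definition int_scale :: "int \<Rightarrow> 'a::ab_group_add \<Rightarrow> 'a" where
  "int_scale n x = (\<Sum>k<nat n. x) - (\<Sum>k<nat (- n). x)"

lemma int_scale_diff_of_nat:
  "int_scale (int p - int q) x = (\<Sum>k<p. x) - (\<Sum>k<q. x)"
proof -
  have add: "(\<Sum>k<m + n. x) = (\<Sum>k<m. x) + (\<Sum>k<n. x)" for m n :: nat
    by (induction n) (simp_all add: algebra_simps)
  show ?thesis
  proof (cases "q \<le> p")
    case True
    then obtain d where "p = q + d" by (metis le_iff_add)
    then show ?thesis by (simp add: int_scale_def add)
  next
    case False
    then obtain d where "q = p + d" by (metis le_iff_add nat_le_linear)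
    then show ?thesis by (simp add: int_scale_def add)
  qed
qed

text \<open>The prefix distinguishes the type-class locale from the \<open>HOL-Algebra\<close> locale of
  the same name.\<close>

global_interpretation int_module: Modules.module "int_scale :: int \<Rightarrow> 'a::ab_group_add \<Rightarrow> 'a"
proof
  fix a b :: int and x y :: 'a
  have add: "(\<Sum>k<m + n. z) = (\<Sum>k<m. z) + (\<Sum>k<n. z)" for m n :: nat and z :: 'a
    by (induction n) (simp_all add: algebra_simps)
  have mult: "(\<Sum>k<m * n. z) = (\<Sum>k<m. \<Sum>k<n. z)" for m n :: nat and z :: 'a
    by (induction m) (simp_all add: add algebra_simps)
  obtain p q where a: "a = int p - int q" by (metis int_diff_cases)
  obtain p' q' where b: "b = int p' - int q'" by (metis int_diff_cases)
  show "int_scale a (x + y) = int_scale a x + int_scale a y"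
    by (simp add: a int_scale_diff_of_nat sum.distrib)
  have "a + b = int (p + p') - int (q + q')" by (simp add: a b)
  then have "int_scale (a + b) x = (\<Sum>k<p + p'. x) - (\<Sum>k<q + q'. x)"
    by (simp only: int_scale_diff_of_nat)
  then show "int_scale (a + b) x = int_scale a x + int_scale b x"
    by (simp add: a b int_scale_diff_of_nat add)
  have "a * b = int (p * p' + q * q') - int (p * q' + q * p')"
    by (simp add: a b algebra_simps)
  then have "int_scale (a * b) x = (\<Sum>k<p * p' + q * q'. x) - (\<Sum>k<p * q' + q * p'. x)"
    by (simp only: int_scale_diff_of_nat)
  then show "int_scale a (int_scale b x) = int_scale (a * b) x"
    by (simp add: a b int_scale_diff_of_nat add mult sum_subtractf)
  show "int_scale 1 x = x" by (simp add: int_scale_def)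
qed

definition fg_free_abelian :: "'l::ab_group_add itself \<Rightarrow> bool" where
  "fg_free_abelian _ \<longleftrightarrow>
    (\<exists>B :: 'l set. finite B \<and> \<not> int_module.dependent B \<and> int_module.span B = UNIV)"

definition additive_homs :: "'q::ab_group_add set \<Rightarrow> ('q \<Rightarrow> 'l::ab_group_add) set" where
  "additive_homs Q = {s. \<forall>\<alpha>\<in>Q. \<forall>\<beta>\<in>Q. s (\<alpha> + \<beta>) = s \<alpha> + s \<beta>}"


section \<open>Associative tori with involution\<close>

locale assoc_algebra = vector_space scale
  for scale :: "'f::field_char_0 \<Rightarrow> 'a::ring_1 \<Rightarrow> 'a" +
  assumes scale_mult_left: "scale c x * y = scale c (x * y)"
    and scale_mult_right: "x * scale c y = scale c (x * y)"

locale graded_assoc_algebra = assoc_algebra scale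
  for scale :: "'f::field_char_0 \<Rightarrow> 'a::ring_1 \<Rightarrow> 'a" +
  fixes A :: "'l::ab_group_add \<Rightarrow> 'a set"
  assumes subspace_component: "subspace (A \<mu>)"
    and direct_sum:
      "\<exists>!c. finite {\<mu>. c \<mu> \<noteq> 0} \<and> (\<forall>\<mu>. c \<mu> \<in> A \<mu>) \<and> x = (\<Sum>\<mu> | c \<mu> \<noteq> 0. c \<mu>)"
    and component_mult: "x \<in> A \<mu> \<Longrightarrow> y \<in> A \<nu> \<Longrightarrow> x * y \<in> A (\<mu> + \<nu>)"

definition grading_support :: "('l \<Rightarrow> 'a::zero set) \<Rightarrow> 'l set" where
  "grading_support A = {\<mu>. A \<mu> \<noteq> {0}}"

locale assoc_torus = graded_assoc_algebra scale A
  for scale :: "'f::field_char_0 \<Rightarrow> 'a::ring_1 \<Rightarrow> 'a" and A :: "'l::ab_group_add \<Rightarrow> 'a set" +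
  assumes spanned_by_invertible:
      "\<mu> \<in> grading_support A \<Longrightarrow> \<exists>u v. A \<mu> = span {u} \<and> u * v = 1 \<and> v * u = 1"
    and support_generates: "int_module.span (grading_support A) = UNIV"

locale assoc_torus_with_involution = assoc_torus scale A
  for scale :: "'f::field_char_0 \<Rightarrow> 'a::ring_1 \<Rightarrow> 'a" and A :: "'l::ab_group_add \<Rightarrow> 'a set" +
  fixes \<iota> :: "'a \<Rightarrow> 'a"
  assumes involution_linear: "Vector_Spaces.linear scale scale \<iota>"
    and involution_bij: "bij \<iota>"
    and involution_mult: "\<iota> (x * y) = \<iota> y * \<iota> x"
    and involution_involutive: "\<iota> (\<iota> x) = x"
    and involution_graded: "\<iota> ` A \<mu> = A \<mu>"

definition hermitian :: "('a \<Rightarrow> 'a) \<Rightarrow> 'a set" where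
  "hermitian \<iota> = {x. \<iota> x = x}"

definition ring_inverse :: "'a::monoid_mult \<Rightarrow> 'a" where
  "ring_inverse x = (THE y. x * y = 1 \<and> y * x = 1)"

definition isotope_involution :: "('a::ring_1 \<Rightarrow> 'a) \<Rightarrow> 'a \<Rightarrow> 'a \<Rightarrow> 'a" where
  "isotope_involution \<iota> h x = h * \<iota> x * ring_inverse h"


section \<open>Graded Lie algebras and their isotopes\<close>

record ('f, 'm, 'q, 'l) graded_lie =
  lie_carrier :: "'m set"
  lie_zero :: 'm
  lie_add :: "'m \<Rightarrow> 'm \<Rightarrow> 'm"
  lie_smult :: "'f \<Rightarrow> 'm \<Rightarrow> 'm"
  lie_bracket :: "'m \<Rightarrow> 'm \<Rightarrow> 'm"
  lie_comp :: "'q \<Rightarrow> 'l \<Rightarrow> 'm set"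

definition graded_isomorphic ::
  "'q set \<Rightarrow> ('f, 'm, 'q, 'l) graded_lie \<Rightarrow> ('f, 'n, 'q, 'l) graded_lie \<Rightarrow> bool" where
  "graded_isomorphic Q L M \<longleftrightarrow>
    (\<exists>\<phi>. bij_betw \<phi> (lie_carrier L) (lie_carrier M) \<and>
      (\<forall>x\<in>lie_carrier L. \<forall>y\<in>lie_carrier L. \<phi> (lie_add L x y) = lie_add M (\<phi> x) (\<phi> y)) \<and>
      (\<forall>c. \<forall>x\<in>lie_carrier L. \<phi> (lie_smult L c x) = lie_smult M c (\<phi> x)) \<and>
      (\<forall>x\<in>lie_carrier L. \<forall>y\<in>lie_carrier L.
         \<phi> (lie_bracket L x y) = lie_bracket M (\<phi> x) (\<phi> y)) \<and>
      (\<forall>\<beta>\<in>Q. \<forall>\<mu>. \<phi> ` lie_comp L \<beta> \<mu> = lie_comp M \<beta> \<mu>))"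

definition lie_isotope ::
  "('q \<Rightarrow> 'l) \<Rightarrow> ('f, 'm, 'q, 'l::ab_group_add) graded_lie \<Rightarrow> ('f, 'm, 'q, 'l) graded_lie" where
  "lie_isotope s L = L\<lparr>lie_comp := (\<lambda>\<beta> \<mu>. lie_comp L \<beta> (\<mu> + s \<beta>))\<rparr>"

definition admissible ::
  "'q::zero set \<Rightarrow> ('q \<Rightarrow> 'l) \<Rightarrow> ('f, 'm, 'q, 'l) graded_lie \<Rightarrow> bool" where
  "admissible \<Delta> s L \<longleftrightarrow> (\<forall>\<beta>\<in>\<Delta> - {0}. lie_comp L \<beta> (s \<beta>) \<noteq> {lie_zero L})"


section \<open>The root system of type C\<close>

text \<open>Everything of rank \<open>r\<close> is indexed by \<open>0, \<dots>, r - 1\<close> rather than \<open>1, \<dots>, r\<close>, as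
  matrices are. The \<open>\<epsilon> i\<close> are the standard basis of a free abelian group.\<close>

definition \<epsilon> :: "nat \<Rightarrow> (nat \<Rightarrow>\<^sub>0 int)" where
  "\<epsilon> i = Poly_Mapping.single i 1"

definition rootsC :: "nat \<Rightarrow> (nat \<Rightarrow>\<^sub>0 int) set" where
  "rootsC r = {0} \<union> {\<epsilon> i - \<epsilon> j | i j. i < r \<and> j < r \<and> i \<noteq> j}
     \<union> {\<epsilon> i + \<epsilon> j | i j. i \<le> j \<and> j < r} \<union> {- (\<epsilon> i + \<epsilon> j) | i j. i \<le> j \<and> j < r}"

definition root_latticeC :: "nat \<Rightarrow> (nat \<Rightarrow>\<^sub>0 int) set" where
  "root_latticeC r = int_module.span (rootsC r)"

definition long_rootC :: "nat \<Rightarrow> (nat \<Rightarrow>\<^sub>0 int)" where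
  "long_rootC r = int_scale 2 (\<epsilon> (r - 1))"


section \<open>The special symplectic Lie algebra of a torus with involution\<close>

definition mat_unit :: "nat \<Rightarrow> nat \<Rightarrow> nat \<Rightarrow> 'a::zero \<Rightarrow> 'a mat" where
  "mat_unit n i j x = mat n n (\<lambda>(k, l). if k = i \<and> l = j then x else 0)"

definition mat_trace :: "'a::comm_monoid_add mat \<Rightarrow> 'a" where
  "mat_trace X = (\<Sum>i<dim_row X. X $$ (i, i))"

definition ell_mat :: "nat \<Rightarrow> ('a::ring_1 \<Rightarrow> 'a) \<Rightarrow> nat \<Rightarrow> nat \<Rightarrow> 'a \<Rightarrow> 'a mat" where
  "ell_mat r \<iota> i j x = mat_unit (2 * r) i j x - mat_unit (2 * r) (j + r) (i + r) (\<iota> x)"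

definition m_mat :: "nat \<Rightarrow> ('a::ring_1 \<Rightarrow> 'a) \<Rightarrow> nat \<Rightarrow> nat \<Rightarrow> 'a \<Rightarrow> 'a mat" where
  "m_mat r \<iota> i j x = mat_unit (2 * r) i (j + r) x + mat_unit (2 * r) j (i + r) (\<iota> x)"

definition n_mat :: "nat \<Rightarrow> ('a::ring_1 \<Rightarrow> 'a) \<Rightarrow> nat \<Rightarrow> nat \<Rightarrow> 'a \<Rightarrow> 'a mat" where
  "n_mat r \<iota> i j x = mat_unit (2 * r) (i + r) j x + mat_unit (2 * r) (j + r) i (\<iota> x)"

text \<open>\<open>A\<^sub>+ + [A, A]\<close>\<close>

definition hermitian_plus_commutators ::
  "('f::field_char_0 \<Rightarrow> 'a::ring_1 \<Rightarrow> 'a) \<Rightarrow> ('a \<Rightarrow> 'a) \<Rightarrow> 'a set" where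
  "hermitian_plus_commutators scale \<iota> =
    {a + b | a b. a \<in> hermitian \<iota> \<and> b \<in> module.span scale {x * y - y * x | x y. True}}"

definition ssp_carrier ::
  "nat \<Rightarrow> ('f::field_char_0 \<Rightarrow> 'a::ring_1 \<Rightarrow> 'a) \<Rightarrow> ('a \<Rightarrow> 'a) \<Rightarrow> 'a mat set" where
  "ssp_carrier r scale \<iota> =
    {four_block_mat X Y Z (- (map_mat \<iota> X)\<^sup>T) | X Y Z.
      X \<in> carrier_mat r r \<and> Y \<in> carrier_mat r r \<and> Z \<in> carrier_mat r r \<and>
      (map_mat \<iota> Y)\<^sup>T = Y \<and> (map_mat \<iota> Z)\<^sup>T = Z \<and>
      mat_trace X \<in> hermitian_plus_commutators scale \<iota>}"

text \<open>For \<open>\<beta> \<noteq> 0\<close> at most one of the last three sets below is nonempty, and it then contains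
  \<open>0\<close>; the set \<open>{0}\<close> only matters when \<open>\<beta>\<close> is not a root.\<close>

definition ssp_comp ::
  "nat \<Rightarrow> ('f::field_char_0 \<Rightarrow> 'a::ring_1 \<Rightarrow> 'a) \<Rightarrow> ('l \<Rightarrow> 'a set) \<Rightarrow> ('a \<Rightarrow> 'a) \<Rightarrow>
    (nat \<Rightarrow>\<^sub>0 int) \<Rightarrow> 'l \<Rightarrow> 'a mat set" where
  "ssp_comp r scale A \<iota> \<beta> \<mu> =
    (if \<beta> = 0 then
       {mat_diag (2 * r) (\<lambda>i. if i < r then x i else - \<iota> (x (i - r))) | x.
         (\<forall>i<r. x i \<in> A \<mu>) \<and> (\<Sum>i<r. x i) \<in> hermitian_plus_commutators scale \<iota>}
     else
       {0\<^sub>m (2 * r) (2 * r)}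
       \<union> {ell_mat r \<iota> i j x | i j x. i < r \<and> j < r \<and> i \<noteq> j \<and> \<beta> = \<epsilon> i - \<epsilon> j \<and> x \<in> A \<mu>}
       \<union> {m_mat r \<iota> i j x | i j x. i \<le> j \<and> j < r \<and> \<beta> = \<epsilon> i + \<epsilon> j \<and> x \<in> A \<mu>}
       \<union> {n_mat r \<iota> i j x | i j x. i \<le> j \<and> j < r \<and> \<beta> = - (\<epsilon> i + \<epsilon> j) \<and> x \<in> A \<mu>})"

definition ssp ::
  "nat \<Rightarrow> ('f::field_char_0 \<Rightarrow> 'a::ring_1 \<Rightarrow> 'a) \<Rightarrow> ('l \<Rightarrow> 'a set) \<Rightarrow> ('a \<Rightarrow> 'a) \<Rightarrow>
    ('f, 'a mat, nat \<Rightarrow>\<^sub>0 int, 'l) graded_lie" where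
  "ssp r scale A \<iota> =
    \<lparr>lie_carrier = ssp_carrier r scale \<iota>,
     lie_zero = 0\<^sub>m (2 * r) (2 * r),
     lie_add = (+),
     lie_smult = (\<lambda>c. map_mat (scale c)),
     lie_bracket = (\<lambda>M N. M * N - N * M),
     lie_comp = ssp_comp r scale A \<iota>\<rparr>"

end

theory Submission
  imports Defs
begin

text \<open>Writing \<open>\<epsilon>\<^bsub>i+r\<^esub> = -\<epsilon>\<^sub>i\<close>, the \<open>(i, j)\<close> entry of a matrix of size \<open>2r\<close> has root
  \<open>\<epsilon>\<^sub>i - \<epsilon>\<^sub>j\<close>.  The isomorphism is conjugation by the diagonal matrix with homogeneous invertible
  entries \<open>d\<^sub>i\<close> of degree \<open>s(\<epsilon>\<^sub>r - \<epsilon>\<^sub>i)\<close> for \<open>i \<le> r\<close>, followed by the entries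
  \<open>h \<iota>(d\<^sub>i)\<^sup>-\<^sup>1\<close>.  The first choice is forced by the degrees, the second by the requirement that
  the short root spaces be defined by \<open>\<iota>\<^sup>(\<^sup>h\<^sup>)\<close>.  Modulo \<open>[A, A]\<close> conjugation does nothing and
  \<open>\<iota>\<^sup>(\<^sup>h\<^sup>)\<close> coincides with \<open>\<iota>\<close>, so the trace condition is unaffected.\<close>

section \<open>Hermitian elements modulo commutators\<close>

context assoc_algebra
begin

abbreviation commutators :: "'a set" where
  "commutators \<equiv> span {x * y - y * x | x y. True}"

lemma commutator_mem: "x * y - y * x \<in> commutators"
  by (rule span_base) blast

text \<open>The difference is itself the single commutator of \<open>a * x\<close> and
  \<open>b\<close>, because \<open>b * a = 1\<close> collapses \<open>b * (a * x)\<close> to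
  \<open>x\<close>.\<close>

lemma conjugate_diff_mem_commutators:
  assumes "b * a = 1"
  shows "a * x * b - x \<in> commutators"
proof -
  have "a * x * b - x = (a * x) * b - b * (a * x)"
    using assms by (simp add: mult.assoc[symmetric])
  then show ?thesis by (simp only: commutator_mem)
qed

text \<open>An antihomomorphism sends the commutator of \<open>a\<close> and \<open>b\<close> to
  that of \<open>\<iota> b\<close> and \<open>\<iota> a\<close>; linearity extends this to the
  span.\<close>

lemma antihom_commutators:
  assumes "Vector_Spaces.linear scale scale \<iota>" and "\<And>x y. \<iota> (x * y) = \<iota> y * \<iota> x"
    and "x \<in> commutators"
  shows "\<iota> x \<in> commutators"
proof -
  interpret L: Vector_Spaces.linear scale scale \<iota> by fact
  show ?thesis
    using assms(3)
  proof (induction rule: span_induct_alt)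
    case base
    then show ?case by (simp add: L.zero span_zero)
  next
    case (step c x y)
    then obtain a b where "x = a * b - b * a" by blast
    then have "\<iota> x = \<iota> b * \<iota> a - \<iota> a * \<iota> b" by (simp add: L.diff assms(2))
    then have "\<iota> x \<in> commutators" by (simp only: commutator_mem)
    with step show ?case by (simp add: L.add L.scale span_add span_scale)
  qed
qed

text \<open>Since 2 is invertible, \<open>x\<close> is the sum of its hermitian part
  \<open>(x + \<iota> x) / 2\<close> and of \<open>-(\<iota> x - x) / 2\<close>. The existential
  definition thus becomes one linear condition on \<open>x\<close> modulo commutators, the form in
  which the trace condition is compared below.\<close>

lemma hermitian_plus_commutators_iff:
  assumes lin: "Vector_Spaces.linear scale scale \<iota>" and anti: "\<And>x y. \<iota> (x * y) = \<iota> y * \<iota> x"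
    and inv: "\<And>x. \<iota> (\<iota> x) = x"
  shows "x \<in> hermitian_plus_commutators scale \<iota> \<longleftrightarrow> \<iota> x - x \<in> commutators"
proof -
  interpret L: Vector_Spaces.linear scale scale \<iota> by fact
  show ?thesis
  proof
    assume "x \<in> hermitian_plus_commutators scale \<iota>"
    then obtain a b where "x = a + b" "\<iota> a = a" "b \<in> commutators"
      unfolding hermitian_plus_commutators_def hermitian_def by blast
    then show "\<iota> x - x \<in> commutators"
      using antihom_commutators[OF lin anti] by (simp add: L.add span_diff)
  next
    assume x: "\<iota> x - x \<in> commutators"
    define a where "a = scale (1/2) (x + \<iota> x)"
    define b where "b = scale (- 1/2) (\<iota> x - x)"
    have "scale (1/2) x + scale (1/2) x = x"
      by (simp flip: scale_left_distrib)
    then have "x = a + b"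
      by (simp add: a_def b_def scale_right_distrib scale_right_diff_distrib)
    moreover have "\<iota> a = a" by (simp add: a_def L.scale L.add inv add.commute)
    moreover have "b \<in> commutators" unfolding b_def using x by (rule span_scale)
    ultimately show "x \<in> hermitian_plus_commutators scale \<iota>"
      unfolding hermitian_plus_commutators_def hermitian_def by blast
  qed
qed

text \<open>Conjugating each summand changes the sum only by a commutator. As \<iota> preserves the
  span of commutators, \<open>\<iota> u - u\<close> keeps its class when \<open>u\<close> is
  replaced by the new sum.\<close>

lemma hermitian_plus_commutators_conjugate:
  assumes "Vector_Spaces.linear scale scale \<iota>" and "\<And>x y. \<iota> (x * y) = \<iota> y * \<iota> x"
    and "\<And>x. \<iota> (\<iota> x) = x"
    and "\<And>i. i < r \<Longrightarrow> d' i * d i = 1"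
    and "(\<Sum>i<r. x i) \<in> hermitian_plus_commutators scale \<iota>"
  shows "(\<Sum>i<r. d i * x i * d' i) \<in> hermitian_plus_commutators scale \<iota>"
proof -
  interpret L: Vector_Spaces.linear scale scale \<iota> by fact
  note iff = hermitian_plus_commutators_iff[OF assms(1-3)]
  let ?u = "\<Sum>i<r. x i" and ?v = "\<Sum>i<r. d i * x i * d' i"
  have d: "?v - ?u \<in> commutators"
    unfolding sum_subtractf[symmetric]
    using assms(4) by (intro span_sum conjugate_diff_mem_commutators) simp
  have "\<iota> ?v - ?v = (\<iota> ?u - ?u) + \<iota> (?v - ?u) - (?v - ?u)"
    by (simp add: L.diff)
  also have "\<dots> \<in> commutators"
    using assms(5)[unfolded iff] antihom_commutators[OF assms(1,2) d] d
    by (rule span_diff[OF span_add])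
  finally show ?thesis by (simp add: iff)
qed

lemma linear_isotope:
  assumes "Vector_Spaces.linear scale scale \<iota>"
  shows "Vector_Spaces.linear scale scale (\<lambda>x. h * \<iota> x * h')"
proof -
  interpret L: Vector_Spaces.linear scale scale \<iota> by fact
  show ?thesis
    by unfold_locales
      (simp_all add: L.add L.scale scale_mult_left scale_mult_right distrib_left distrib_right)
qed

text \<open>The twisted map is again an involution because \<open>h\<close> and \<open>h'\<close>
  are hermitian, so the linear criterion applies to it. Its value at \<open>x\<close> is a conjugate
  of \<open>\<iota> x\<close>, hence congruent to \<open>\<iota> x\<close> modulo commutators, and
  the two criteria agree.\<close>

lemma hermitian_plus_commutators_isotope:
  assumes lin: "Vector_Spaces.linear scale scale \<iota>" and anti: "\<And>x y. \<iota> (x * y) = \<iota> y * \<iota> x"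
    and inv: "\<And>x. \<iota> (\<iota> x) = x"
    and h: "\<iota> h = h" "\<iota> h' = h'" "h * h' = 1" "h' * h = 1"
  shows "hermitian_plus_commutators scale (\<lambda>x. h * \<iota> x * h') = hermitian_plus_commutators scale \<iota>"
proof (rule Set.set_eqI)
  fix x
  let ?\<kappa> = "\<lambda>x. h * \<iota> x * h'"
  have cancel: "h' * (h * y) = y" "h * (h' * y) = y" for y
    by (simp_all add: h mult.assoc[symmetric])
  have "x \<in> hermitian_plus_commutators scale ?\<kappa> \<longleftrightarrow> ?\<kappa> x - x \<in> commutators"
    by (rule hermitian_plus_commutators_iff[OF linear_isotope[OF lin]])
      (simp_all add: anti inv h mult.assoc cancel)
  also have "\<dots> \<longleftrightarrow> \<iota> x - x \<in> commutators"
  proof -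
    have "?\<kappa> x - \<iota> x \<in> commutators" using h(4) by (rule conjugate_diff_mem_commutators)
    moreover have "?\<kappa> x - x = (?\<kappa> x - \<iota> x) + (\<iota> x - x)" by simp
    ultimately show ?thesis by (simp only: span_add_eq)
  qed
  also have "\<dots> \<longleftrightarrow> x \<in> hermitian_plus_commutators scale \<iota>"
    by (simp add: hermitian_plus_commutators_iff[OF lin anti inv])
  finally show "x \<in> hermitian_plus_commutators scale ?\<kappa> \<longleftrightarrow> x \<in> hermitian_plus_commutators scale \<iota>" .
qed

end

lemma ring_inverse_eq:
  assumes "x * y = 1" "y * x = 1"
  shows "ring_inverse x = y"
  unfolding ring_inverse_def
proof (rule the_equality)
  fix z assume "x * z = 1 \<and> z * x = 1"
  then show "z = y" using assms by (metis mult.assoc mult_1_left mult_1_right)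
qed (use assms in blast)


section \<open>Homogeneous units\<close>

context assoc_torus
begin

lemma nonzero_homogeneous:
  assumes "x \<in> A \<mu>" "x \<noteq> 0"
  obtains u v k where "A \<mu> = span {u}" "u * v = 1" "v * u = 1" "x = scale k u" "k \<noteq> 0"
proof -
  have "\<mu> \<in> grading_support A" using assms by (auto simp: grading_support_def)
  then obtain u v where uv: "A \<mu> = span {u}" "u * v = 1" "v * u = 1"
    using spanned_by_invertible by blast
  with assms obtain k where "x = scale k u" by (auto simp: span_singleton)
  with uv assms that show thesis by (metis scale_zero_left)
qed

lemma nonzero_homogeneous_unit:
  assumes "x \<in> A \<mu>" "x \<noteq> 0"
  obtains y where "x * y = 1" "y * x = 1"
proof -
  obtain u v k where "u * v = 1" "v * u = 1" "x = scale k u" "k \<noteq> 0"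
    using nonzero_homogeneous[OF assms] by metis
  then have "x * scale (1/k) v = 1" "scale (1/k) v * x = 1"
    by (simp_all add: scale_mult_left scale_mult_right)
  then show thesis by (rule that)
qed

text \<open>The torus axioms give an inverse without a degree. A nonzero element of the opposite
  degree repairs this: \<open>x * y\<close> is a nonzero scalar, so a multiple of \<open>y\<close>
  is the inverse.\<close>

lemma homogeneous_inverse:
  assumes x: "x \<in> A \<mu>" "x \<noteq> 0" and y: "y \<in> A (- \<mu>)" "y \<noteq> 0"
  obtains z where "z \<in> A (- \<mu>)" "x * z = 1" "z * x = 1"
proof -
  obtain x' where x': "x * x' = 1" "x' * x = 1" using nonzero_homogeneous_unit[OF x] .
  have xy: "x * y \<in> A 0" using component_mult[OF x(1) y(1)] by simp
  have "x * y \<noteq> 0"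
  proof
    assume "x * y = 0"
    then have "x' * x * y = 0" by (simp add: mult.assoc)
    with x' y(2) show False by simp
  qed
  then obtain w w' k where w: "A 0 = span {w}" "w * w' = 1" "x * y = scale k w" "k \<noteq> 0"
    using nonzero_homogeneous[OF xy] by metis
  \<comment> \<open>The degree 0 component consists of the scalars: its generator satisfies
    \<open>w * w = c w\<close> by closure under products, and cancelling the unit \<open>w\<close>
    leaves \<open>w = c 1\<close>.\<close>
  have "w \<in> A 0" by (simp add: w(1) span_base)
  then have "w * w \<in> span {w}" using component_mult[of w 0 w 0] w(1) by simp
  then obtain c where "w * w = scale c w" by (auto simp: span_singleton)
  then have "w * w * w' = scale c w * w'" by simp
  then have "w = scale c 1" using w(2) by (simp add: mult.assoc scale_mult_left)
  then have xyk: "x * y = scale (k * c) 1" using w(3) by simp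
  then have kc: "k * c \<noteq> 0" using \<open>x * y \<noteq> 0\<close> by auto
  define z where "z = scale (1 / (k * c)) y"
  have "z \<in> A (- \<mu>)" unfolding z_def using subspace_component y(1) by (rule subspace_scale)
  moreover have xz: "x * z = 1" using xyk kc by (simp add: z_def scale_mult_right)
  \<comment> \<open>A right inverse of a unit equals its two-sided inverse, so
    \<open>z * x = 1\<close> comes for free.\<close>
  moreover have "x' = z" using x' xz by (metis mult.assoc mult_1_left mult_1_right)
  ultimately show thesis using that x' by blast
qed

end


section \<open>Conjugation by a diagonal matrix\<close>

text \<open>Conjugation by the diagonal matrix with entries \<open>D\<close>, written entrywise. The
  intended inverse entries \<open>D'\<close> are a separate parameter, so that exchanging the two
  families gives the inverse map.\<close>

definition diag_conj :: "nat \<Rightarrow> (nat \<Rightarrow> 'a) \<Rightarrow> (nat \<Rightarrow> 'a) \<Rightarrow> 'a::ring_1 mat \<Rightarrow> 'a mat" where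
  "diag_conj n D D' M = mat n n (\<lambda>(i, j). D i * M $$ (i, j) * D' j)"

lemma diag_conj_carrier [simp]: "diag_conj n D D' M \<in> carrier_mat n n"
  and diag_conj_index [simp]:
    "i < n \<Longrightarrow> j < n \<Longrightarrow> diag_conj n D D' M $$ (i, j) = D i * M $$ (i, j) * D' j"
  and diag_conj_dim [simp]: "dim_row (diag_conj n D D' M) = n" "dim_col (diag_conj n D D' M) = n"
  by (simp_all add: diag_conj_def)

lemma diag_conj_inverse:
  assumes "M \<in> carrier_mat n n" "\<And>i. i < n \<Longrightarrow> D i * D' i = 1" "\<And>i. i < n \<Longrightarrow> D' i * D i = 1"
  shows "diag_conj n D' D (diag_conj n D D' M) = M"
proof (rule eq_matI)
  fix i j assume "i < dim_row M" "j < dim_col M"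
  then have ij: "i < n" "j < n" using assms by auto
  then have "D' i * (D i * M $$ (i, j) * D' j) * D j = (D' i * D i) * M $$ (i, j) * (D' j * D j)"
    by (simp add: mult.assoc)
  then show "diag_conj n D' D (diag_conj n D D' M) $$ (i, j) = M $$ (i, j)"
    using assms ij by simp
qed (use assms in auto)

lemma diag_conj_add:
  assumes "M \<in> carrier_mat n n" "N \<in> carrier_mat n n"
  shows "diag_conj n D D' (M + N) = diag_conj n D D' M + diag_conj n D D' N"
  using assms by (intro eq_matI) (auto simp: distrib_left distrib_right)

lemma diag_conj_diff:
  assumes "M \<in> carrier_mat n n" "N \<in> carrier_mat n n"
  shows "diag_conj n D D' (M - N) = diag_conj n D D' M - diag_conj n D D' N"
  using assms by (intro eq_matI) (auto simp: right_diff_distrib left_diff_distrib)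

lemma diag_conj_mult:
  assumes M: "M \<in> carrier_mat n n" and N: "N \<in> carrier_mat n n"
    and D: "\<And>i. i < n \<Longrightarrow> D' i * D i = 1"
  shows "diag_conj n D D' (M * N) = diag_conj n D D' M * diag_conj n D D' N"
proof (rule eq_matI)
  fix i j assume "i < dim_row (diag_conj n D D' M * diag_conj n D D' N)"
    and "j < dim_col (diag_conj n D D' M * diag_conj n D D' N)"
  then have ij: "i < n" "j < n" by auto
  have "(diag_conj n D D' M * diag_conj n D D' N) $$ (i, j)
      = (\<Sum>k = 0..<n. D i * M $$ (i, k) * D' k * (D k * N $$ (k, j) * D' j))"
    using ij by (simp add: scalar_prod_def)
  also have "\<dots> = (\<Sum>k = 0..<n. D i * (M $$ (i, k) * N $$ (k, j)) * D' j)"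
  proof (rule sum.cong)
    fix k assume "k \<in> {0..<n}"
    then have "D i * M $$ (i, k) * D' k * (D k * N $$ (k, j) * D' j)
        = D i * M $$ (i, k) * (D' k * D k) * N $$ (k, j) * D' j"
      by (simp add: mult.assoc)
    with \<open>k \<in> {0..<n}\<close> D show "D i * M $$ (i, k) * D' k * (D k * N $$ (k, j) * D' j)
        = D i * (M $$ (i, k) * N $$ (k, j)) * D' j"
      by (simp add: mult.assoc)
  qed simp
  also have "\<dots> = diag_conj n D D' (M * N) $$ (i, j)"
    using M N ij by (simp add: scalar_prod_def sum_distrib_left sum_distrib_right)
  finally show "diag_conj n D D' (M * N) $$ (i, j)
      = (diag_conj n D D' M * diag_conj n D D' N) $$ (i, j)" by simp
qed auto

lemma mat_unit_carrier [simp]: "mat_unit n a b x \<in> carrier_mat n n"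
  and mat_unit_index [simp]:
    "i < n \<Longrightarrow> j < n \<Longrightarrow> mat_unit n a b x $$ (i, j) = (if i = a \<and> j = b then x else 0)"
  and mat_unit_dim [simp]: "dim_row (mat_unit n a b x) = n" "dim_col (mat_unit n a b x) = n"
  by (simp_all add: mat_unit_def)

lemma mat_unit_zero [simp]: "mat_unit n a b 0 = 0\<^sub>m n n"
  by (rule eq_matI) auto

lemma diag_conj_mat_unit:
  "diag_conj n D D' (mat_unit n a b x) = mat_unit n a b (D a * x * D' b)"
  by (rule eq_matI) auto

lemma diag_conj_zero: "diag_conj n D D' (0\<^sub>m n n) = 0\<^sub>m n n"
  by (rule eq_matI) auto


section \<open>Conjugation of the special symplectic Lie algebra\<close>

text \<open>The block conditions entry by entry. Each one determines an entry from its mirror image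
  under the transpose combined with the exchange of the two halves of the index range, so its
  behaviour under diagonal conjugation can be checked one entry at a time.\<close>

lemma ssp_carrier_iff:
  "M \<in> ssp_carrier r scale \<iota> \<longleftrightarrow>
    M \<in> carrier_mat (2 * r) (2 * r) \<and>
    (\<forall>i<r. \<forall>j<r. M $$ (j + r, i + r) = - \<iota> (M $$ (i, j))) \<and>
    (\<forall>i<r. \<forall>j<r. M $$ (j, i + r) = \<iota> (M $$ (i, j + r))) \<and>
    (\<forall>i<r. \<forall>j<r. M $$ (j + r, i) = \<iota> (M $$ (i + r, j))) \<and>
    (\<Sum>i<r. M $$ (i, i)) \<in> hermitian_plus_commutators scale \<iota>"
    (is "_ \<longleftrightarrow> ?R")
proof
  assume "M \<in> ssp_carrier r scale \<iota>"
  then obtain X Y Z where M: "M = four_block_mat X Y Z (- (map_mat \<iota> X)\<^sup>T)"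
    and c: "X \<in> carrier_mat r r" "Y \<in> carrier_mat r r" "Z \<in> carrier_mat r r"
    and Y: "(map_mat \<iota> Y)\<^sup>T = Y" and Z: "(map_mat \<iota> Z)\<^sup>T = Z"
    and t: "mat_trace X \<in> hermitian_plus_commutators scale \<iota>"
    unfolding ssp_carrier_def by blast
  have "M \<in> carrier_mat (2 * r) (2 * r)"
    unfolding M mult_2 using c by (intro four_block_carrier_mat) auto
  moreover have Y': "\<iota> (Y $$ (i, j)) = Y $$ (j, i)" and Z': "\<iota> (Z $$ (i, j)) = Z $$ (j, i)"
    if "i < r" "j < r" for i j
    using arg_cong[OF Y, of "\<lambda>W. W $$ (j, i)"] arg_cong[OF Z, of "\<lambda>W. W $$ (j, i)"] c that
    by auto
  ultimately show ?R
  proof (intro conjI allI impI)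
    fix i j assume ij: "i < r" "j < r"
    show "M $$ (j + r, i + r) = - \<iota> (M $$ (i, j))" using c ij by (simp add: M)
    show "M $$ (j, i + r) = \<iota> (M $$ (i, j + r))" using c ij by (simp add: M Y')
    show "M $$ (j + r, i) = \<iota> (M $$ (i + r, j))" using c ij by (simp add: M Z')
  next
    show "(\<Sum>i<r. M $$ (i, i)) \<in> hermitian_plus_commutators scale \<iota>"
      using c t by (simp add: M mat_trace_def)
  qed
next
  assume R: ?R
  then have carrier: "M \<in> carrier_mat (2 * r) (2 * r)"
    and lower: "\<And>i j. i < r \<Longrightarrow> j < r \<Longrightarrow> M $$ (j + r, i + r) = - \<iota> (M $$ (i, j))"
    and off_diagonal: "\<And>i j. i < r \<Longrightarrow> j < r \<Longrightarrow> M $$ (j, i + r) = \<iota> (M $$ (i, j + r))"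
      "\<And>i j. i < r \<Longrightarrow> j < r \<Longrightarrow> M $$ (j + r, i) = \<iota> (M $$ (i + r, j))"
    by blast+
  define X where "X = mat r r (\<lambda>(i, j). M $$ (i, j))"
  define Y where "Y = mat r r (\<lambda>(i, j). M $$ (i, j + r))"
  define Z where "Z = mat r r (\<lambda>(i, j). M $$ (i + r, j))"
  have c: "X \<in> carrier_mat r r" "Y \<in> carrier_mat r r" "Z \<in> carrier_mat r r"
    by (simp_all add: X_def Y_def Z_def)
  have "M = four_block_mat X Y Z (- (map_mat \<iota> X)\<^sup>T)"
  proof (rule eq_matI)
    fix i j
    assume "i < dim_row (four_block_mat X Y Z (- (map_mat \<iota> X)\<^sup>T))"
      and "j < dim_col (four_block_mat X Y Z (- (map_mat \<iota> X)\<^sup>T))"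
    then have ij: "i < r + r" "j < r + r" using c by auto
    show "M $$ (i, j) = four_block_mat X Y Z (- (map_mat \<iota> X)\<^sup>T) $$ (i, j)"
    proof (cases "i < r \<or> j < r")
      case True
      with ij c show ?thesis by (auto simp: X_def Y_def Z_def)
    next
      case False
      then obtain a b where ab: "i = a + r" "j = b + r" by (metis le_add_diff_inverse2 not_less)
      then have "M $$ (i, j) = - \<iota> (M $$ (b, a))" using lower ij by simp
      with False ij c show ?thesis by (simp add: X_def ab)
    qed
  qed (use c carrier in auto)
  moreover have "(map_mat \<iota> Y)\<^sup>T = Y" "(map_mat \<iota> Z)\<^sup>T = Z"
    by (auto intro!: eq_matI simp: Y_def Z_def off_diagonal[symmetric])
  moreover have "mat_trace X \<in> hermitian_plus_commutators scale \<iota>"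
    using R[THEN conjunct2, THEN conjunct2, THEN conjunct2, THEN conjunct2]
    by (simp add: mat_trace_def X_def)
  ultimately show "M \<in> ssp_carrier r scale \<iota>"
    unfolding ssp_carrier_def using c by blast
qed

lemma lookup_epsilon: "Poly_Mapping.lookup (\<epsilon> i) k = (if i = k then 1 else 0)"
  by (simp add: \<epsilon>_def lookup_single when_def)

lemma epsilon_eq_iff [simp]: "\<epsilon> i = \<epsilon> j \<longleftrightarrow> i = j"
  by (metis lookup_epsilon zero_neq_one)

lemma epsilon_add_nonzero [simp]: "\<epsilon> i + \<epsilon> j \<noteq> 0"
proof
  assume "\<epsilon> i + \<epsilon> j = 0"
  then have "Poly_Mapping.lookup (\<epsilon> i + \<epsilon> j) i = 0" by simp
  then show False by (simp add: lookup_add lookup_epsilon split: if_splits)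
qed

lemma ell_mat_mem_ssp_comp:
  assumes "i < r" "j < r" "i \<noteq> j" "x \<in> A \<mu>"
  shows "ell_mat r \<iota> i j x \<in> ssp_comp r scale A \<iota> (\<epsilon> i - \<epsilon> j) \<mu>"
proof -
  have nonzero: "\<epsilon> i - \<epsilon> j \<noteq> 0" using assms by simp
  show ?thesis unfolding ssp_comp_def if_not_P[OF nonzero] 
    using assms by - (rule UnI1, rule UnI1, rule UnI2, blast)
qed

lemma m_mat_mem_ssp_comp:
  assumes "i \<le> j" "j < r" "x \<in> A \<mu>"
  shows "m_mat r \<iota> i j x \<in> ssp_comp r scale A \<iota> (\<epsilon> i + \<epsilon> j) \<mu>"
  unfolding ssp_comp_def if_not_P[OF epsilon_add_nonzero] 
  using assms by - (rule UnI1, rule UnI2, blast)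

lemma n_mat_mem_ssp_comp:
  assumes "i \<le> j" "j < r" "x \<in> A \<mu>"
  shows "n_mat r \<iota> i j x \<in> ssp_comp r scale A \<iota> (- (\<epsilon> i + \<epsilon> j)) \<mu>"
proof -
  have nonzero: "- (\<epsilon> i + \<epsilon> j) \<noteq> 0" by (metis epsilon_add_nonzero neg_equal_0_iff_equal)
  show ?thesis unfolding ssp_comp_def if_not_P[OF nonzero] 
    using assms by - (rule UnI2, blast)
qed

lemma ssp_comp_cases:
  assumes "M \<in> ssp_comp r scale A \<iota> \<beta> \<mu>" "\<beta> \<noteq> 0"
  obtains "M = 0\<^sub>m (2 * r) (2 * r)"
    | i j x where "M = ell_mat r \<iota> i j x" "i < r" "j < r" "i \<noteq> j" "\<beta> = \<epsilon> i - \<epsilon> j" "x \<in> A \<mu>"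
    | i j x where "M = m_mat r \<iota> i j x" "i \<le> j" "j < r" "\<beta> = \<epsilon> i + \<epsilon> j" "x \<in> A \<mu>"
    | i j x where "M = n_mat r \<iota> i j x" "i \<le> j" "j < r" "\<beta> = - (\<epsilon> i + \<epsilon> j)" "x \<in> A \<mu>"
  using assms(1) unfolding ssp_comp_def if_not_P[OF assms(2)] by blast

lemma ssp_comp_carrier:
  assumes "M \<in> ssp_comp r scale A \<iota> \<beta> \<mu>"
  shows "M \<in> carrier_mat (2 * r) (2 * r)"
proof (cases "\<beta> = 0")
  case True
  with assms show ?thesis by (auto simp: ssp_comp_def)
next
  case False
  with assms show ?thesis
    by (cases rule: ssp_comp_cases)
      (simp_all add: ell_mat_def m_mat_def n_mat_def minus_carrier_mat)
qed

text \<open>\<open>L\<^sub>\<beta>\<close> consists of the matrices supported on the entries \<open>(i, j)\<close> with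
  \<open>entry_weight r i - entry_weight r j = \<beta>\<close>;
  \<open>entry_dual r\<close> pairs the basis vectors that are dual under the defining form.\<close>

definition entry_weight :: "nat \<Rightarrow> nat \<Rightarrow> (nat \<Rightarrow>\<^sub>0 int)" where
  "entry_weight r i = (if i < r then \<epsilon> i else - \<epsilon> (i - r))"

definition entry_dual :: "nat \<Rightarrow> nat \<Rightarrow> nat" where
  "entry_dual r i = (if i < r then i + r else i - r)"

text \<open>What conjugation needs in order to carry the algebra of \<iota> into that of \<kappa>:
  compatibility with the two adjoints, entry by entry, and with the trace condition. The locale is
  instantiated a second time with \<iota>, \<kappa> and \<open>D\<close>, \<open>D'\<close>
  exchanged, for the inverse map.\<close>

locale diagonal_intertwiner =
  fixes r :: nat and scale :: "'f::field_char_0 \<Rightarrow> 'a::ring_1 \<Rightarrow> 'a"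
    and \<iota> \<kappa> :: "'a \<Rightarrow> 'a" and D D' :: "nat \<Rightarrow> 'a"
  assumes intertwine: "\<And>i j x. i < 2 * r \<Longrightarrow> j < 2 * r \<Longrightarrow>
      \<kappa> (D i * x * D' j) = D (entry_dual r j) * \<iota> x * D' (entry_dual r i)"
    and trace: "\<And>x. (\<Sum>i<r. x i) \<in> hermitian_plus_commutators scale \<iota> \<Longrightarrow>
      (\<Sum>i<r. D i * x i * D' i) \<in> hermitian_plus_commutators scale \<kappa>"
begin

lemma intertwine_blocks:
  assumes "i < r" "j < r"
  shows "\<kappa> (D i * x * D' j) = D (j + r) * \<iota> x * D' (i + r)"
    and "\<kappa> (D i * x * D' (j + r)) = D j * \<iota> x * D' (i + r)"
    and "\<kappa> (D (i + r) * x * D' j) = D (j + r) * \<iota> x * D' i"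
  using assms intertwine[of i j x] intertwine[of i "j + r" x] intertwine[of "i + r" j x]
  by (simp_all add: entry_dual_def)

lemma diag_conj_ssp_carrier:
  assumes "M \<in> ssp_carrier r scale \<iota>"
  shows "diag_conj (2 * r) D D' M \<in> ssp_carrier r scale \<kappa>"
proof -
  note M = assms[unfolded ssp_carrier_iff]
  have blocks: "M $$ (j + r, i + r) = - \<iota> (M $$ (i, j))" "M $$ (j, i + r) = \<iota> (M $$ (i, j + r))"
      "M $$ (j + r, i) = \<iota> (M $$ (i + r, j))" if "i < r" "j < r" for i j
    using M that by blast+
  have tr: "(\<Sum>i<r. D i * M $$ (i, i) * D' i) \<in> hermitian_plus_commutators scale \<kappa>"
    by (rule trace) (use M in blast)
  show ?thesis
    unfolding ssp_carrier_iff
  proof (intro conjI allI impI)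
    let ?N = "diag_conj (2 * r) D D' M"
    fix i j assume ij: "i < r" "j < r"
    show "?N $$ (j + r, i + r) = - \<kappa> (?N $$ (i, j))"
      using ij by (simp add: blocks(1)[OF ij] intertwine_blocks)
    show "?N $$ (j, i + r) = \<kappa> (?N $$ (i, j + r))"
      using ij by (simp add: blocks(2)[OF ij] intertwine_blocks)
    show "?N $$ (j + r, i) = \<kappa> (?N $$ (i + r, j))"
      using ij by (simp add: blocks(3)[OF ij] intertwine_blocks)
  qed (use tr in auto)
qed

lemma diag_conj_ell_mat:
  assumes "i < r" "j < r"
  shows "diag_conj (2 * r) D D' (ell_mat r \<iota> i j x) = ell_mat r \<kappa> i j (D i * x * D' j)"
  using assms by (simp add: ell_mat_def diag_conj_diff diag_conj_mat_unit intertwine_blocks)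

lemma diag_conj_m_mat:
  assumes "i < r" "j < r"
  shows "diag_conj (2 * r) D D' (m_mat r \<iota> i j x) = m_mat r \<kappa> i j (D i * x * D' (j + r))"
  using assms by (simp add: m_mat_def diag_conj_add diag_conj_mat_unit intertwine_blocks)

lemma diag_conj_n_mat:
  assumes "i < r" "j < r"
  shows "diag_conj (2 * r) D D' (n_mat r \<iota> i j x) = n_mat r \<kappa> i j (D (i + r) * x * D' j)"
  using assms by (simp add: n_mat_def diag_conj_add diag_conj_mat_unit intertwine_blocks)

text \<open>The degree hypothesis concerns a single root \<beta>, since the shift of degrees depends
  on \<beta>. With \<mu> and \<nu> arbitrary, the lemma serves both the map and its inverse.\<close>

lemma diag_conj_ssp_comp:
  assumes deg: "\<And>i j x. i < 2 * r \<Longrightarrow> j < 2 * r \<Longrightarrow> entry_weight r i - entry_weight r j = \<beta> \<Longrightarrow>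
      x \<in> A \<mu> \<Longrightarrow> D i * x * D' j \<in> A \<nu>"
    and M: "M \<in> ssp_comp r scale A \<iota> \<beta> \<mu>"
  shows "diag_conj (2 * r) D D' M \<in> ssp_comp r scale A \<kappa> \<beta> \<nu>"
proof (cases "\<beta> = 0")
  case True
  then obtain x where M': "M = mat_diag (2 * r) (\<lambda>i. if i < r then x i else - \<iota> (x (i - r)))"
    and x: "\<And>i. i < r \<Longrightarrow> x i \<in> A \<mu>" "(\<Sum>i<r. x i) \<in> hermitian_plus_commutators scale \<iota>"
    using M by (auto simp: ssp_comp_def)
  define y where "y i = D i * x i * D' i" for i
  \<comment> \<open>The intertwining relation at equal indices: the lower half of the conjugated
    diagonal is determined by the upper half through \<kappa>.\<close>
  have lower: "- (D i * \<iota> (x (i - r)) * D' i) = - \<kappa> (y (i - r))" if "r \<le> i" "i < 2 * r" for i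
    using that intertwine_blocks(1)[of "i - r" "i - r" "x (i - r)"] by (simp add: y_def)
  have "diag_conj (2 * r) D D' M = mat_diag (2 * r) (\<lambda>i. if i < r then y i else - \<kappa> (y (i - r)))"
    unfolding M' by (rule eq_matI) (auto simp: mat_diag_def y_def lower[unfolded y_def])
  moreover have "\<forall>i<r. y i \<in> A \<nu>" using x True by (auto simp: y_def intro!: deg)
  moreover have "(\<Sum>i<r. y i) \<in> hermitian_plus_commutators scale \<kappa>"
    unfolding y_def using x(2) by (rule trace)
  ultimately show ?thesis using True unfolding ssp_comp_def by auto
next
  case False
  show ?thesis
    using M False
  proof (cases rule: ssp_comp_cases)
    case 1
    then show ?thesis using False by (simp add: ssp_comp_def diag_conj_zero)
  next
    case (2 i j x)
    then have ij: "i < r" "j < r" by simp_all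
    have y: "D i * x * D' j \<in> A \<nu>" using 2 ij by (intro deg) (auto simp: entry_weight_def)
    show ?thesis
      unfolding 2(1) 2(5) diag_conj_ell_mat[OF ij]
      using ij 2(4) y by (rule ell_mat_mem_ssp_comp)
  next
    case (3 i j x)
    then have ij: "i < r" "j < r" by simp_all
    have y: "D i * x * D' (j + r) \<in> A \<nu>" using 3 ij by (intro deg) (auto simp: entry_weight_def)
    show ?thesis
      unfolding 3(1) 3(4) diag_conj_m_mat[OF ij]
      using 3(2,3) y by (rule m_mat_mem_ssp_comp)
  next
    case (4 i j x)
    then have ij: "i < r" "j < r" by simp_all
    have y: "D (i + r) * x * D' j \<in> A \<nu>" using 4 ij by (intro deg) (auto simp: entry_weight_def)
    show ?thesis
      unfolding 4(1) 4(4) diag_conj_n_mat[OF ij]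
      using 4(2,3) y by (rule n_mat_mem_ssp_comp)
  qed
qed

end


section \<open>Admissible shifts\<close>

lemma long_rootC_eq: "long_rootC r = \<epsilon> (r - 1) + \<epsilon> (r - 1)"
  by (simp add: long_rootC_def int_scale_def numeral_2_eq_2)

lemma epsilon_diff_mem_rootsC:
  assumes "i < r" "j < r"
  shows "\<epsilon> i - \<epsilon> j \<in> rootsC r"
proof (cases "i = j")
  case True
  then show ?thesis by (simp add: rootsC_def)
next
  case False
  with assms have "\<epsilon> i - \<epsilon> j \<in> {\<epsilon> i - \<epsilon> j | i j. i < r \<and> j < r \<and> i \<noteq> j}"
    by blast
  then show ?thesis unfolding rootsC_def by - (rule UnI1, rule UnI1, rule UnI2)
qed

text \<open>The weights themselves are not in the root lattice, as all roots have even coefficient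
  sum. Only their differences are, being roots or 0, and additivity of the shift is available only
  on the lattice.\<close>

lemma entry_weight_diff_mem_root_latticeC:
  assumes "i < 2 * r" "j < 2 * r"
  shows "entry_weight r i - entry_weight r j \<in> root_latticeC r"
proof -
  have pm: "\<epsilon> a + \<epsilon> b \<in> rootsC r \<and> - (\<epsilon> a + \<epsilon> b) \<in> rootsC r \<and> \<epsilon> a - \<epsilon> b \<in> rootsC r"
    if "a < r" "b < r" for a b
  proof -
    have "\<epsilon> a + \<epsilon> b \<in> rootsC r \<and> - (\<epsilon> a + \<epsilon> b) \<in> rootsC r"
    proof (cases "a \<le> b")
      case True
      with that show ?thesis unfolding rootsC_def by blast
    next
      case False
      then have "b \<le> a" by simp
      with that show ?thesis unfolding rootsC_def add.commute[of "\<epsilon> a"] by blast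
    qed
    moreover have "\<epsilon> a - \<epsilon> b \<in> rootsC r"
      using that by (rule epsilon_diff_mem_rootsC)
    ultimately show ?thesis by blast
  qed
  have eqs: "entry_weight r i - entry_weight r j =
      (if i < r then if j < r then \<epsilon> i - \<epsilon> j else \<epsilon> i + \<epsilon> (j - r)
       else if j < r then - (\<epsilon> (i - r) + \<epsilon> j) else \<epsilon> (j - r) - \<epsilon> (i - r))"
    by (simp add: entry_weight_def)
  have "entry_weight r i - entry_weight r j \<in> rootsC r"
    unfolding eqs using assms pm by auto
  then show ?thesis unfolding root_latticeC_def by (rule int_module.span_base)
qed

lemma additive_homs_diff:
  assumes "s \<in> additive_homs (root_latticeC r)" "x \<in> root_latticeC r" "y \<in> root_latticeC r"
  shows "s (x - y) = s x - s y"
proof -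
  have "x - y \<in> root_latticeC r"
    using assms(2,3) unfolding root_latticeC_def by (rule int_module.span_diff)
  then have "s ((x - y) + y) = s (x - y) + s y"
    using assms(1,3) unfolding additive_homs_def by blast
  then show ?thesis by simp
qed

text \<open>For use in contrapositive form: a nonzero root component of the Lie algebra forces a
  nonzero component of \<open>A\<close>, which is how admissibility yields homogeneous
  elements.\<close>

lemma ssp_comp_trivial:
  assumes "\<iota> 0 = 0" "\<beta> \<noteq> 0" "A \<mu> = {0}"
  shows "ssp_comp r scale A \<iota> \<beta> \<mu> = {0\<^sub>m (2 * r) (2 * r)}"
proof
  show "ssp_comp r scale A \<iota> \<beta> \<mu> \<subseteq> {0\<^sub>m (2 * r) (2 * r)}"
  proof
    fix M assume "M \<in> ssp_comp r scale A \<iota> \<beta> \<mu>"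
    then show "M \<in> {0\<^sub>m (2 * r) (2 * r)}"
      using assms(2)
      by (cases rule: ssp_comp_cases)
        (simp_all add: assms(1,3) ell_mat_def m_mat_def n_mat_def)
  qed
  show "{0\<^sub>m (2 * r) (2 * r)} \<subseteq> ssp_comp r scale A \<iota> \<beta> \<mu>"
    using assms(2) by (simp add: ssp_comp_def)
qed

context assoc_torus_with_involution
begin

lemma involution_zero: "\<iota> 0 = 0"
  using involution_linear by (rule module_hom.zero[OF Vector_Spaces.linear.axioms(3)])

lemma admissible_obtains:
  assumes adm: "admissible (rootsC r) s (ssp r scale A \<iota>)" and \<beta>: "\<beta> \<in> rootsC r" "\<beta> \<noteq> 0"
  obtains x where "x \<in> A (s \<beta>)" "x \<noteq> 0"
proof -
  have "ssp_comp r scale A \<iota> \<beta> (s \<beta>) \<noteq> {0\<^sub>m (2 * r) (2 * r)}"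
    using adm \<beta> by (simp add: admissible_def ssp_def)
  then have "A (s \<beta>) \<noteq> {0}"
    using ssp_comp_trivial[of \<iota> \<beta> A "s \<beta>" r scale, OF involution_zero \<beta>(2)] by (rule contrapos_nn)
  moreover have "0 \<in> A (s \<beta>)" using subspace_component by (rule subspace_0)
  ultimately show thesis using that by blast
qed

text \<open>The long root space consists of matrices with the single entry
  \<open>x + \<iota> x\<close>. Admissibility makes such an entry nonzero, which gives a nonzero
  hermitian element in a one-dimensional component; \<iota> then fixes the whole line, including
  \<open>h\<close>.\<close>

lemma admissible_hermitian:
  assumes adm: "admissible (rootsC r) s (ssp r scale A \<iota>)" and r: "0 < r"
    and h: "h \<in> A (s (long_rootC r))"
  shows "\<iota> h = h"
proof -
  interpret L: Vector_Spaces.linear scale scale \<iota> by (rule involution_linear)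
  let ?l = "r - 1" and ?\<beta> = "long_rootC r"
  have \<beta>: "?\<beta> \<noteq> 0" unfolding long_rootC_eq by (rule epsilon_add_nonzero)
  have "?l < r" using r by simp
  then have \<beta>r: "?\<beta> \<in> rootsC r" unfolding long_rootC_eq rootsC_def by blast
  \<comment> \<open>The coefficient 2 at the last index identifies the root: a difference of two
    basis vectors has coefficient at most 1 there, a negative sum at most 0, and a sum reaches 2
    only if both indices are the last one.\<close>
  have lookup: "Poly_Mapping.lookup ?\<beta> ?l = 2"
    unfolding long_rootC_eq lookup_add lookup_epsilon by simp
  have no_short: "?\<beta> \<noteq> \<epsilon> i - \<epsilon> j" and no_neg: "?\<beta> \<noteq> - (\<epsilon> i + \<epsilon> j)"
    and long: "?\<beta> = \<epsilon> i + \<epsilon> j \<Longrightarrow> i = ?l \<and> j = ?l" for i j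
    using lookup by (auto simp: lookup_minus lookup_add lookup_epsilon split: if_splits)
  have "ssp_comp r scale A \<iota> ?\<beta> (s ?\<beta>) \<noteq> {0\<^sub>m (2 * r) (2 * r)}"
    using adm \<beta> \<beta>r by (simp add: admissible_def ssp_def)
  moreover have "0\<^sub>m (2 * r) (2 * r) \<in> ssp_comp r scale A \<iota> ?\<beta> (s ?\<beta>)"
    using \<beta> by (simp add: ssp_comp_def)
  ultimately obtain M where M: "M \<in> ssp_comp r scale A \<iota> ?\<beta> (s ?\<beta>)" "M \<noteq> 0\<^sub>m (2 * r) (2 * r)"
    by blast
  from M(1) \<beta> obtain x where x: "x \<in> A (s ?\<beta>)" "m_mat r \<iota> ?l ?l x \<noteq> 0\<^sub>m (2 * r) (2 * r)"
  proof (cases rule: ssp_comp_cases)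
    case (3 i j x)
    with M(2) long[of i j] that show thesis by simp
  qed (use M(2) no_short no_neg in blast)+
  define y where "y = x + \<iota> x"
  have "m_mat r \<iota> ?l ?l x = mat_unit (2 * r) ?l (?l + r) y"
    by (rule eq_matI) (auto simp: m_mat_def y_def)
  with x(2) have "y \<noteq> 0" by auto
  moreover have "y \<in> A (s ?\<beta>)"
    unfolding y_def using subspace_component x(1) involution_graded by (blast intro: subspace_add)
  ultimately obtain u k where u: "A (s ?\<beta>) = span {u}" and yu: "y = scale k u" "k \<noteq> 0"
    using nonzero_homogeneous by metis
  have "\<iota> y = y" by (simp add: y_def L.add involution_involutive add.commute)
  then have "scale k (\<iota> u) = scale k u" by (simp add: yu L.scale)
  then have "\<iota> u = u" using yu(2) by simp
  moreover obtain c where "h = scale c u" using h u by (auto simp: span_singleton)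
  ultimately show ?thesis by (simp add: L.scale)
qed

end


theorem proposition11p8:
  fixes r :: nat
    and scale :: "'f::field_char_0 \<Rightarrow> 'a::ring_1 \<Rightarrow> 'a"
    and A :: "'l::ab_group_add \<Rightarrow> 'a set"
    and \<iota> :: "'a \<Rightarrow> 'a"
    and s :: "(nat \<Rightarrow>\<^sub>0 int) \<Rightarrow> 'l"
    and h :: 'a
  assumes "4 \<le> r"
    and "fg_free_abelian TYPE('l)"
    and "assoc_torus_with_involution scale A \<iota>"
    and "s \<in> additive_homs (root_latticeC r)"
    and "admissible (rootsC r) s (ssp r scale A \<iota>)"
    and "h \<in> A (s (long_rootC r))" and "h \<noteq> 0"
  shows "graded_isomorphic (root_latticeC r)
           (lie_isotope s (ssp r scale A \<iota>))
           (ssp r scale A (isotope_involution \<iota> h))"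
proof -
  interpret assoc_torus_with_involution scale A \<iota> by fact
  note adm = assms(5)
  let ?w = "entry_weight r"
  \<comment> \<open>The zero-based index of the last basis vector, whose double is the long
    root.\<close>
  define l where "l = r - 1"
  have r: "0 < r" "l < r" "l < 2 * r" using assms(1) by (auto simp: l_def)
  have long: "long_rootC r = \<epsilon> l + \<epsilon> l" by (simp only: long_rootC_eq l_def)
  \<comment> \<open>Degrees are measured relative to the weight at \<open>l\<close>, because
    \<open>s\<close> is controlled only on differences of weights. The diagonal entry
    \<open>D i\<close> will have degree \<open>- p i\<close> and its inverse degree
    \<open>p i\<close>.\<close>
  define p where "p i = s (?w i - ?w l)" for i
  have shift: "s (?w i - ?w j) = p i - p j" if "i < 2 * r" "j < 2 * r" for i j
  proof -
    have "?w i - ?w j = (?w i - ?w l) - (?w j - ?w l)" by simp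
    then show ?thesis
      using that r unfolding p_def
      by (simp only: additive_homs_diff[OF assms(4)] entry_weight_diff_mem_root_latticeC)
  qed
  have p_last: "p l = 0" using shift[of l l] r by (simp add: p_def)
  define q where "q = s (long_rootC r)"
  have q: "q = - p (l + r)"
    using shift[of l "l + r"] r p_last by (simp add: q_def long entry_weight_def)
  \<comment> \<open>Matches the lower diagonal entries: \<open>h * \<iota> (d' i)\<close> has degree
    \<open>q + p i\<close>, which is \<open>- p (i + r)\<close>.\<close>
  have p_lower: "p (i + r) = - p i - q" if "i < r" for i
  proof -
    have "?w (i + r) - ?w (l + r) = ?w l - ?w i" using that r by (simp add: entry_weight_def)
    then have "p (i + r) - p (l + r) = p l - p i"
      using shift[of "i + r" "l + r"] shift[of l i] that r by simp
    then show ?thesis by (simp add: q p_last algebra_simps)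
  qed

  have hA: "h \<in> A q" using assms(6) by (simp add: q_def)
  have mq: "s (- (\<epsilon> l + \<epsilon> l)) = - q"
    using shift[of "l + r" l] r p_last p_lower[of l] by (simp add: entry_weight_def)
  \<comment> \<open>The negative long root supplies a nonzero element of degree \<open>- q\<close>,
    so the inverse of \<open>h\<close> is homogeneous.\<close>
  have "- (\<epsilon> l + \<epsilon> l) \<in> rootsC r" using r(2) unfolding rootsC_def by blast
  then obtain y where "y \<in> A (- q)" "y \<noteq> 0"
    using admissible_obtains[OF adm] mq by (metis epsilon_add_nonzero neg_equal_0_iff_equal)
  then obtain h' where h': "h' \<in> A (- q)" "h * h' = 1" "h' * h = 1"
    using homogeneous_inverse[OF hA assms(7)] by metis
  have \<iota>h: "\<iota> h = h" using admissible_hermitian[OF adm r(1) assms(6)] .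
  interpret L: Vector_Spaces.linear scale scale \<iota> by (rule involution_linear)
  have one: "\<iota> 1 = 1"
    by (metis involution_mult involution_involutive mult_1_left)
  have \<iota>h': "\<iota> h' = h'"
  proof -
    have "\<iota> h' * h = 1" using h' \<iota>h involution_mult[of h h'] by (simp add: one)
    then show ?thesis by (metis h'(2) mult.assoc mult_1_left mult_1_right)
  qed

  \<comment> \<open>For \<open>i\<close> different from \<open>l\<close>, admissibility at a short
    root and at its negative gives nonzero elements in both degrees. For \<open>i = l\<close> the
    difference of weights is 0, where admissibility says nothing, and 1 is taken instead.\<close>
  have "\<exists>d d'. d \<in> A (- p i) \<and> d' \<in> A (p i) \<and> d * d' = 1 \<and> d' * d = 1" if i: "i < r" for i
  proof (cases "i = l")
    case True
    have "1 \<in> A 0" using component_mult[OF hA h'(1)] h'(2) by simp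
    then show ?thesis using True p_last by force
  next
    case False
    have pi: "s (\<epsilon> i - \<epsilon> l) = p i" "s (\<epsilon> l - \<epsilon> i) = - p i"
      using shift[of i l] shift[of l i] i r p_last by (simp_all add: entry_weight_def)
    have "\<epsilon> i - \<epsilon> l \<in> rootsC r" "\<epsilon> l - \<epsilon> i \<in> rootsC r"
      using i r by (simp_all add: epsilon_diff_mem_rootsC)
    moreover have "\<epsilon> i - \<epsilon> l \<noteq> 0" "\<epsilon> l - \<epsilon> i \<noteq> 0" using False by auto
    ultimately obtain x y where "x \<in> A (p i)" "x \<noteq> 0" "y \<in> A (- p i)" "y \<noteq> 0"
      using admissible_obtains[OF adm] pi by metis
    then show ?thesis using homogeneous_inverse by metis
  qed
  then obtain d d' where d: "\<And>i. i < r \<Longrightarrow> d i \<in> A (- p i)" "\<And>i. i < r \<Longrightarrow> d' i \<in> A (p i)"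
      "\<And>i. i < r \<Longrightarrow> d i * d' i = 1" "\<And>i. i < r \<Longrightarrow> d' i * d i = 1"
    by metis

  define D where "D i = (if i < r then d i else h * \<iota> (d' (i - r)))" for i
  define D' where "D' i = (if i < r then d' i else \<iota> (d (i - r)) * h')" for i
  define \<kappa> where "\<kappa> x = h * \<iota> x * h'" for x
  have \<kappa>: "isotope_involution \<iota> h = \<kappa>"
    using ring_inverse_eq[OF h'(2,3)] by (auto simp: isotope_involution_def \<kappa>_def)
  have cancel: "h' * (h * y) = y" "h * (h' * y) = y" for y
    by (simp_all add: h' mult.assoc[symmetric])
  have \<iota>d: "\<iota> (d i) * \<iota> (d' i) = 1" "\<iota> (d' i) * \<iota> (d i) = 1" if "i < r" for i
    using d(3,4)[OF that] by (simp_all add: involution_mult[symmetric] one)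
  have \<iota>d_cancel: "\<iota> (d i) * (\<iota> (d' i) * y) = y" "\<iota> (d' i) * (\<iota> (d i) * y) = y" if "i < r" for i y
    using \<iota>d[OF that] by (simp_all add: mult.assoc[symmetric])
  have DD': "D i * D' i = 1" and D'D: "D' i * D i = 1" if "i < 2 * r" for i
    using that d(3,4)
    by (auto simp: D_def D'_def mult.assoc cancel \<iota>d_cancel \<iota>d h')
  have \<iota>A: "x \<in> A \<mu> \<Longrightarrow> \<iota> x \<in> A \<mu>" for x \<mu> using involution_graded by blast
  have degD: "D i \<in> A (- p i)" and degD': "D' i \<in> A (p i)" if "i < 2 * r" for i
  proof -
    have "D i \<in> A (- p i) \<and> D' i \<in> A (p i)"
    proof (cases "i < r")
      case True
      then show ?thesis by (simp add: D_def D'_def d)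
    next
      case False
      define k where "k = i - r"
      then have k: "k < r" "i = k + r" using False that by auto
      have "h * \<iota> (d' k) \<in> A (q + p k)" "\<iota> (d k) * h' \<in> A (- p k + - q)"
        using k d hA h'(1) by (intro component_mult \<iota>A; simp)+
      then show ?thesis using k p_lower[of k] by (simp add: D_def D'_def)
    qed
    then show "D i \<in> A (- p i)" "D' i \<in> A (p i)" by auto
  qed
  \<comment> \<open>One case for each block. In the upper left one, for instance, both sides are
    \<open>h * \<iota> (d' j) * \<iota> x * \<iota> (d i) * h'\<close>; in the others, factors
    \<open>h\<close> and \<open>h'\<close> cancel since both are hermitian.\<close>
  have intertwine: "\<kappa> (D i * x * D' j) = D (entry_dual r j) * \<iota> x * D' (entry_dual r i)"
    if "i < 2 * r" "j < 2 * r" for i j x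
    using that
    by (auto simp: \<kappa>_def D_def D'_def entry_dual_def involution_mult involution_involutive \<iota>h \<iota>h'
        mult.assoc cancel h')
  have H: "hermitian_plus_commutators scale \<kappa> = hermitian_plus_commutators scale \<iota>"
    unfolding \<kappa>_def
    by (rule hermitian_plus_commutators_isotope[OF involution_linear involution_mult
          involution_involutive \<iota>h \<iota>h' h'(2,3)])
  note conj = hermitian_plus_commutators_conjugate[OF involution_linear involution_mult
      involution_involutive]
  interpret F: diagonal_intertwiner r scale \<iota> \<kappa> D D'
  proof
    fix x assume "(\<Sum>i<r. x i) \<in> hermitian_plus_commutators scale \<iota>"
    then show "(\<Sum>i<r. D i * x i * D' i) \<in> hermitian_plus_commutators scale \<kappa>"
      unfolding H by (rule conj[rotated]) (simp add: D'D)
  qed (fact intertwine)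
  \<comment> \<open>The reverse relation follows from the forward one applied to
    \<open>D' i * x * D j\<close>, whose conjugate is \<open>x\<close>, by cancelling the diagonal
    entries at the dual indices.\<close>
  interpret B: diagonal_intertwiner r scale \<kappa> \<iota> D' D
  proof
    fix i j x assume ij: "i < 2 * r" "j < 2 * r"
    let ?i = "entry_dual r i" and ?j = "entry_dual r j"
    have dual: "?i < 2 * r" "?j < 2 * r" using ij by (auto simp: entry_dual_def)
    have x: "D i * (D' i * x * D j) * D' j = x"
      using DD'[OF ij(1)] DD'[OF ij(2)] by (metis mult.assoc mult_1_left mult_1_right)
    have "D' ?j * \<kappa> x * D ?i = D' ?j * (D ?j * \<iota> (D' i * x * D j) * D' ?i) * D ?i"
      using intertwine[OF ij, of "D' i * x * D j"] by (simp only: x)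
    also have "\<dots> = \<iota> (D' i * x * D j)"
      using D'D[OF dual(1)] D'D[OF dual(2)] by (metis mult.assoc mult_1_left mult_1_right)
    finally show "\<iota> (D' i * x * D j) = D' ?j * \<kappa> x * D ?i" by simp
  next
    fix x assume "(\<Sum>i<r. x i) \<in> hermitian_plus_commutators scale \<kappa>"
    then show "(\<Sum>i<r. D' i * x i * D i) \<in> hermitian_plus_commutators scale \<iota>"
      unfolding H by (rule conj[rotated]) (simp add: DD')
  qed

  let ?n = "2 * r"
  define \<phi> where "\<phi> = diag_conj ?n D D'"
  define \<psi> where "\<psi> = diag_conj ?n D' D"
  have inverse: "\<psi> (\<phi> M) = M" "\<phi> (\<psi> M) = M" if "M \<in> carrier_mat ?n ?n" for M
    unfolding \<phi>_def \<psi>_def using that DD' D'D by (auto intro!: diag_conj_inverse)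
  have carrier: "M \<in> carrier_mat ?n ?n" if "M \<in> ssp_carrier r scale \<sigma>" for M \<sigma>
    using that by (simp add: ssp_carrier_iff)
  have "bij_betw \<phi> (ssp_carrier r scale \<iota>) (ssp_carrier r scale \<kappa>)"
    by (rule bij_betw_byWitness[where f' = \<psi>])
      (auto simp: inverse carrier F.diag_conj_ssp_carrier[folded \<phi>_def]
        B.diag_conj_ssp_carrier[folded \<psi>_def])
  moreover have "\<phi> (M + N) = \<phi> M + \<phi> N"
    if "M \<in> ssp_carrier r scale \<iota>" "N \<in> ssp_carrier r scale \<iota>" for M N
    unfolding \<phi>_def using that carrier by (intro diag_conj_add) auto
  moreover have "\<phi> (map_mat (scale c) M) = map_mat (scale c) (\<phi> M)"
    if "M \<in> ssp_carrier r scale \<iota>" for c M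
    unfolding \<phi>_def using carrier[OF that]
    by (intro eq_matI) (auto simp: scale_mult_left scale_mult_right)
  moreover have "\<phi> (M * N - N * M) = \<phi> M * \<phi> N - \<phi> N * \<phi> M"
    if "M \<in> ssp_carrier r scale \<iota>" "N \<in> ssp_carrier r scale \<iota>" for M N
    unfolding \<phi>_def using carrier[OF that(1)] carrier[OF that(2)]
    by (subst diag_conj_diff) (auto simp: diag_conj_mult D'D)
  moreover have "\<phi> ` ssp_comp r scale A \<iota> \<beta> (\<mu> + s \<beta>) = ssp_comp r scale A \<kappa> \<beta> \<mu>" for \<beta> \<mu>
  proof
    show "\<phi> ` ssp_comp r scale A \<iota> \<beta> (\<mu> + s \<beta>) \<subseteq> ssp_comp r scale A \<kappa> \<beta> \<mu>"
    proof (rule image_subsetI)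
      fix M assume M: "M \<in> ssp_comp r scale A \<iota> \<beta> (\<mu> + s \<beta>)"
      show "\<phi> M \<in> ssp_comp r scale A \<kappa> \<beta> \<mu>"
        unfolding \<phi>_def
      proof (rule F.diag_conj_ssp_comp[OF _ M])
        fix i j x assume ij: "i < ?n" "j < ?n" "?w i - ?w j = \<beta>" and x: "x \<in> A (\<mu> + s \<beta>)"
        \<comment> \<open>The shift cancels exactly: \<open>p i - p j = s \<beta>\<close> for every
          entry of weight \<beta>, so the degree drops from \<open>\<mu> + s \<beta>\<close> to
          \<mu>. The inverse map restores it below.\<close>
        have "D i * x * D' j \<in> A (- p i + (\<mu> + s \<beta>) + p j)"
          by (intro component_mult degD degD' ij x)
        then show "D i * x * D' j \<in> A \<mu>" using shift[OF ij(1,2)] ij(3) by simp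
      qed
    qed
    have "M \<in> \<phi> ` ssp_comp r scale A \<iota> \<beta> (\<mu> + s \<beta>)" if M: "M \<in> ssp_comp r scale A \<kappa> \<beta> \<mu>" for M
    proof (rule image_eqI)
      have "M \<in> carrier_mat ?n ?n"
        using M by (rule ssp_comp_carrier)
      then show "M = \<phi> (\<psi> M)" by (simp add: inverse)
      show "\<psi> M \<in> ssp_comp r scale A \<iota> \<beta> (\<mu> + s \<beta>)"
        unfolding \<psi>_def
      proof (rule B.diag_conj_ssp_comp[OF _ M])
        fix i j x assume ij: "i < ?n" "j < ?n" "?w i - ?w j = \<beta>" and x: "x \<in> A \<mu>"
        have "D' i * x * D j \<in> A (p i + \<mu> + - p j)"
          by (intro component_mult degD degD' ij x)
        moreover have "p i + \<mu> + - p j = \<mu> + s \<beta>" using shift[OF ij(1,2)] ij(3) by simp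
        ultimately show "D' i * x * D j \<in> A (\<mu> + s \<beta>)" by (simp only:)
      qed
    qed
    then show "ssp_comp r scale A \<kappa> \<beta> \<mu> \<subseteq> \<phi> ` ssp_comp r scale A \<iota> \<beta> (\<mu> + s \<beta>)" by blast
  qed
  ultimately show ?thesis
    unfolding graded_isomorphic_def \<kappa>
    by (intro exI[of _ \<phi>]) (simp add: lie_isotope_def ssp_def)
qed

end
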